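(* Fix an algebraic statistical model $X\subset\mathbb{P}^n$ and data $u=(u_0,\dots,u_n)\in(\mathbb{C}^* )^{n+1}$ with $u_+:=u_0+\cdots+u_n\neq 0$. Let $X'\subset\mathbb{P}^{n+1}$ be the embedding of $X$ with the extra coordinate $p_s=p_0+\cdots+p_n$, and let $N_{X'}\subset\mathbb{P}^{n+1}\times\mathbb{P}^{n+1}$ be its conormal variety. A point $$\big([p_0:p_1:\dots:p_n:p_s],[b_0:b_1:\dots:b_n:b_s]\big)\in N_{X'}$$ satisfies the relation $$[p_0b_0:p_1b_1:\dots:p_nb_n:p_sb_s]=[u_0:u_1:\dots:u_n:-u_+]$$ if and only if $[p_0:p_1:\dots:p_n:p_s]$ is a critical point of $l_u'(p)=p_0^{u_0}p_1^{u_1}\cdots p_n^{u_n}p_s^{-u_+}$ on $X'$.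
   Context: An algebraic statistical model $X\subset\mathbb{P}^n$ is an irreducible, generically reduced complex projective variety defined by homogeneous polynomials $f_1,\dots,f_k$ in $p_0,\dots,p_n$. The variety $X'\subset\mathbb{P}^{n+1}$, with coordinates $p_0,\dots,p_n,p_s$, is defined by the vanishing of $f_1,\dots,f_k$ and of $-p_0-p_1-\cdots-p_n+p_s$. For a projective variety $Z\subset\mathbb{P}^m$, $Z_{reg}$ is the set of its nonsingular points; $T_pZ$ for $p\in Z_{reg}$ denotes the tangent space at $p$ viewed as a linear subspace of $\mathbb{C}^{m+1}$ (the tangent space of the affine cone over $Z$), and $q\perp T_pZ$ means $\sum_i q_iv_i=0$ for all $v\in T_pZ$. The conormal variety of $Z$ is the Zariski closure $$N_Z=\overline{\{(p,q): p\in Z_{reg},\ q\perp T_pZ\}}\subset\mathbb{P}^m\times\mathbb{P}^m .$$ A critical point of $l_u'$ on $X'$ is a point $p\in X'_{reg}$ with $p_0p_1\cdots p_np_s\neq0$ such that the gradient of $l_u'$, which up to scaling is $\left[\frac{u_0}{p_0},\dots,\frac{u_n}{p_n},-\frac{u_+}{p_s}\right]$, satisfies $\left[\frac{u_0}{p_0},\dots,\frac{u_n}{p_n},-\frac{u_+}{p_s}\right]\perp T_pX'$.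
   Formalization: The point p is assumed to be a nonsingular point of X' (the claim fails at singular points for some u), and the claim reads: some b with (p,b) in N_{X'} satisfies the relation if and only if p is a critical point. *)

theory Defs
  imports
    "HOL-Analysis.Analysis"
    "HOL-Library.Poly_Mapping"
    "HOL-Library.Extended_Nat"
begin

type_synonym 'v mpoly = "('v \<Rightarrow>\<^sub>0 nat) \<Rightarrow>\<^sub>0 complex"

definition mp_eval :: "'v::finite mpoly \<Rightarrow> ('v \<Rightarrow> complex) \<Rightarrow> complex" where
  "mp_eval f x = (\<Sum>m\<in>Poly_Mapping.keys f.
     Poly_Mapping.lookup f m * (\<Prod>i\<in>UNIV. x i ^ Poly_Mapping.lookup m i))"

text \<open>The subtraction of exponents truncates only when \<open>i\<close> does not occur in the monomial
  \<open>m\<close>, and then the coefficient is zero.\<close>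

definition mp_partial :: "'v::finite \<Rightarrow> 'v mpoly \<Rightarrow> 'v mpoly" where
  "mp_partial i f = (\<Sum>m\<in>Poly_Mapping.keys f.
     Poly_Mapping.single (m - Poly_Mapping.single i 1)
       (of_nat (Poly_Mapping.lookup m i) * Poly_Mapping.lookup f m))"

definition homogeneous :: "'v::finite mpoly \<Rightarrow> bool" where
  "homogeneous f \<longleftrightarrow>
     (\<exists>d. \<forall>m\<in>Poly_Mapping.keys f. (\<Sum>i\<in>UNIV. Poly_Mapping.lookup m i) = d)"

definition bihomogeneous :: "('n::finite + 'n) mpoly \<Rightarrow> bool" where
  "bihomogeneous f \<longleftrightarrow>
     (\<exists>d e. \<forall>m\<in>Poly_Mapping.keys f.
        (\<Sum>i\<in>UNIV. Poly_Mapping.lookup m (Inl i)) = d \<and>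
        (\<Sum>i\<in>UNIV. Poly_Mapping.lookup m (Inr i)) = e)"

definition ideal_gen :: "'v::finite mpoly set \<Rightarrow> 'v mpoly set" where
  "ideal_gen F = {g. \<exists>a. g = (\<Sum>f\<in>F. a f * f)}"

definition proj_eq :: "complex^'n::finite \<Rightarrow> complex^'n \<Rightarrow> bool" where
  "proj_eq x y \<longleftrightarrow> x \<noteq> 0 \<and> y \<noteq> 0 \<and> (\<exists>c. c \<noteq> 0 \<and> y = c *s x)"

lemma part_equivp_proj_eq: "part_equivp proj_eq"
proof (rule part_equivpI)
  have "proj_eq (1 :: complex^'n) 1"
    unfolding proj_eq_def by (auto intro: exI[of _ 1])
  then show "\<exists>x :: complex^'n. proj_eq x x" by blast
  show "symp (proj_eq :: complex^'n \<Rightarrow> _)"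
  proof (rule sympI)
    fix x y :: "complex^'n"
    assume "proj_eq x y"
    then obtain c where "c \<noteq> 0" "y = c *s x" "x \<noteq> 0" "y \<noteq> 0"
      unfolding proj_eq_def by blast
    then show "proj_eq y x"
      unfolding proj_eq_def by (auto intro!: exI[of _ "inverse c"] simp: vector_smult_assoc)
  qed
  show "transp (proj_eq :: complex^'n \<Rightarrow> _)"
  proof (rule transpI)
    fix x y z :: "complex^'n"
    assume "proj_eq x y" "proj_eq y z"
    then obtain c d where "c \<noteq> 0" "y = c *s x" "d \<noteq> 0" "z = d *s y" "x \<noteq> 0" "z \<noteq> 0"
      unfolding proj_eq_def by blast
    then show "proj_eq x z"
      unfolding proj_eq_def by (auto intro!: exI[of _ "d * c"] simp: vector_smult_assoc)
  qed
qed

text \<open>\<open>'n cproj\<close> is the complex projective space with homogeneous coordinates indexed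
  by the finite type \<open>'n\<close>, i.e. of dimension \<open>CARD('n) - 1\<close>.  The quotient is partial, so
  \<open>pt x\<close> is meaningful only for \<open>x \<noteq> 0\<close>.\<close>

quotient_type 'n cproj = "complex^'n::finite" / partial: proj_eq
  morphisms rep_pt pt
  by (rule part_equivp_proj_eq)

definition coords :: "'n::finite cproj \<Rightarrow> (complex^'n) set" where
  "coords P = {x. x \<noteq> 0 \<and> pt x = P}"

definition proj_zeros :: "'n::finite mpoly set \<Rightarrow> 'n cproj set" where
  "proj_zeros F = {P. \<forall>f\<in>F. \<forall>x\<in>coords P. mp_eval f (($) x) = 0}"

definition zariski_closed :: "'n::finite cproj set \<Rightarrow> bool" where
  "zariski_closed A \<longleftrightarrow> (\<exists>F. (\<forall>f\<in>F. homogeneous f) \<and> A = proj_zeros F)"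

definition zariski_irreducible :: "'n::finite cproj set \<Rightarrow> bool" where
  "zariski_irreducible A \<longleftrightarrow> A \<noteq> {} \<and>
     (\<forall>B C. zariski_closed B \<and> zariski_closed C \<and> A \<subseteq> B \<union> C \<longrightarrow> A \<subseteq> B \<or> A \<subseteq> C)"

definition zariski_dim :: "'n::finite cproj set \<Rightarrow> enat" where
  "zariski_dim Z = Sup {enat d | d. \<exists>W.
     (\<forall>i\<le>d. zariski_closed (W i) \<and> zariski_irreducible (W i) \<and> W i \<subseteq> Z) \<and>
     (\<forall>i<d. W i \<subset> W (Suc i))}"

definition bi_zariski_closed :: "('n::finite cproj \<times> 'n cproj) set \<Rightarrow> bool" where
  "bi_zariski_closed A \<longleftrightarrow> (\<exists>F. (\<forall>f\<in>F. bihomogeneous f) \<and>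
     A = {(P, Q). \<forall>f\<in>F. \<forall>x\<in>coords P. \<forall>y\<in>coords Q.
            mp_eval f (case_sum (($) x) (($) y)) = 0})"

definition vanishing_ideal :: "'n::finite cproj set \<Rightarrow> 'n mpoly set" where
  "vanishing_ideal Z = {g. \<forall>P\<in>Z. \<forall>x\<in>coords P. mp_eval g (($) x) = 0}"

text \<open>The tangent space of the affine cone over \<open>Z\<close>; it is the same at every
  representative of \<open>P\<close>.\<close>

definition tangent_space :: "'n::finite cproj set \<Rightarrow> 'n cproj \<Rightarrow> (complex^'n) set" where
  "tangent_space Z P = {v. \<forall>g\<in>vanishing_ideal Z. \<forall>x\<in>coords P.
     (\<Sum>i\<in>UNIV. mp_eval (mp_partial i g) (($) x) * v $ i) = 0}"

text \<open>The affine cone over \<open>Z\<close> has dimension \<open>dim Z + 1\<close>.  For irreducible \<open>Z\<close> the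
  dimension at every point is that of \<open>Z\<close>.\<close>

definition reg_points :: "'n::finite cproj set \<Rightarrow> 'n cproj set" where
  "reg_points Z = {P \<in> Z. enat (vec.dim (tangent_space Z P)) = zariski_dim Z + 1}"

definition perp :: "complex^'n::finite \<Rightarrow> (complex^'n) set \<Rightarrow> bool" where
  "perp q T \<longleftrightarrow> (\<forall>v\<in>T. (\<Sum>i\<in>UNIV. q $ i * v $ i) = 0)"

definition conormal :: "'n::finite cproj set \<Rightarrow> ('n cproj \<times> 'n cproj) set" where
  "conormal Z = bi_zariski_closed hull
     {(P, Q). P \<in> reg_points Z \<and> (\<forall>q\<in>coords Q. perp q (tangent_space Z P))}"

text \<open>The scheme cut out by \<open>F\<close> is reduced at its generic point: the localization of
  \<open>\<complex>[p] / \<langle>F\<rangle>\<close> at the vanishing ideal of the zero set (a prime ideal when that set is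
  irreducible) has no nonzero nilpotent elements.\<close>

definition generically_reduced :: "'n::finite mpoly set \<Rightarrow> bool" where
  "generically_reduced F \<longleftrightarrow> (\<forall>g k s.
     s \<notin> vanishing_ideal (proj_zeros F) \<and> s * g ^ k \<in> ideal_gen F \<longrightarrow>
     (\<exists>t. t \<notin> vanishing_ideal (proj_zeros F) \<and> t * g \<in> ideal_gen F))"

definition statistical_model :: "'n::finite mpoly set \<Rightarrow> bool" where
  "statistical_model F \<longleftrightarrow> finite F \<and> (\<forall>f\<in>F. homogeneous f) \<and>
     zariski_irreducible (proj_zeros F) \<and> generically_reduced F"

text \<open>Coordinates with indices in \<open>'n option\<close>: \<open>Some i\<close> stands for \<open>p\<^sub>i\<close> and \<open>None\<close>
  for the additional coordinate \<open>p\<^sub>s\<close>.\<close>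

definition extended_model :: "'n::finite mpoly set \<Rightarrow> 'n option cproj set" where
  "extended_model F = {P. \<forall>x\<in>coords P.
     (\<forall>f\<in>F. mp_eval f (\<lambda>i. x $ Some i) = 0) \<and>
     - (\<Sum>i\<in>UNIV. x $ Some i) + x $ None = 0}"

definition extended_data :: "complex^'n::finite \<Rightarrow> complex^('n option)" where
  "extended_data u = (\<chi> i. case i of Some j \<Rightarrow> u $ j | None \<Rightarrow> - (\<Sum>j\<in>UNIV. u $ j))"

text \<open>The vector with entries \<open>u\<^sub>i / p\<^sub>i\<close> and \<open>- u\<^sub>+ / p\<^sub>s\<close> is the gradient of the
  (multivalued) function \<open>\<Prod>\<^sub>i p\<^sub>i powr u\<^sub>i * p\<^sub>s powr (- u\<^sub>+)\<close> divided by the value of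
  that function.\<close>

definition likelihood_grad :: "complex^'n::finite \<Rightarrow> complex^('n option) \<Rightarrow> complex^('n option)"
  where "likelihood_grad u x = (\<chi> i. extended_data u $ i / x $ i)"

definition critical_point ::
    "complex^'n::finite \<Rightarrow> 'n option cproj set \<Rightarrow> 'n option cproj \<Rightarrow> bool" where
  "critical_point u Z P \<longleftrightarrow> P \<in> reg_points Z \<and>
     (\<forall>x\<in>coords P. (\<Prod>i\<in>UNIV. x $ i) \<noteq> 0 \<and>
        perp (likelihood_grad u x) (tangent_space Z P))"

end

theory Submission
  imports Defs
begin

text \<open>Write \<open>Z\<close> for the extended model.  At a point with nonzero coordinates the relation
  \<open>[p\<^sub>i b\<^sub>i] = [u : - u\<^sub>+]\<close> says exactly that \<open>b\<close> is a multiple of the likelihood gradient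
  at \<open>p\<close>, and the relation itself forces the coordinates of \<open>p\<close> to be nonzero, as those of
  the right-hand side are.  The equivalence is therefore immediate as soon as membership of
  \<open>(p, b)\<close> in the conormal variety means \<open>b \<perp> T\<^sub>p Z\<close>.  One implication holds because
  a set is contained in its closure.  The content lies in the other one: passing to the
  Zariski closure adds no points over the regular points of \<open>Z\<close>
  (\<open>conormal_fibre_over_regular_point\<close>).

  To see this, let \<open>p\<close> be regular and \<open>q\<close> not orthogonal to \<open>T\<^sub>p Z\<close>.  Choose polynomials
  \<open>g\<^sub>i\<close> in the vanishing ideal whose gradients at \<open>p\<close> form a basis of the span of all such
  gradients; the orthogonal complement of this span is \<open>T\<^sub>p Z\<close>, so \<open>q\<close> is independent of
  them.  Complete \<open>q\<close> and these gradients to a basis of the whole space by constant vectors.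
  The determinant with these rows, in which \<open>p\<close> and \<open>q\<close> are now variables \<open>x\<close> and \<open>y\<close>, is a
  polynomial that is nonzero at \<open>(p, q)\<close>.  It vanishes whenever \<open>x\<close> is regular and
  \<open>y \<perp> T\<^sub>x Z\<close>: otherwise the rows other than the constant ones would be independent, so their
  common kernel, which contains \<open>T\<^sub>x Z\<close>, would have one dimension less than \<open>T\<^sub>p Z\<close>, whereas
  the tangent spaces at all regular points have the same dimension.

  Closed sets are cut out by bihomogeneous polynomials, and the determinant need not be one, since
  the \<open>g\<^sub>i\<close> are arbitrary.  But the set under consideration is stable under rescaling \<open>x\<close> and
  \<open>y\<close> separately, so every bihomogeneous part of the determinant vanishes on it as well, and
  some part is nonzero at \<open>(p, q)\<close> (\<open>poly_fun_vanishes_on_hull\<close>).\<close>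

section \<open>Polynomial functions\<close>

lemma mp_eval_superset:
  assumes "finite K" "Poly_Mapping.keys f \<subseteq> K"
  shows "mp_eval f x = (\<Sum>m\<in>K. Poly_Mapping.lookup f m *
    (\<Prod>i\<in>UNIV. x i ^ Poly_Mapping.lookup m i))"
  unfolding mp_eval_def
  by (rule sum.mono_neutral_left) (use assms in \<open>auto simp: in_keys_iff\<close>)

lemma mp_eval_zero [simp]: "mp_eval 0 x = 0"
  by (simp add: mp_eval_def)

lemma mp_eval_single:
  "mp_eval (Poly_Mapping.single m c) x = c * (\<Prod>i\<in>UNIV. x i ^ Poly_Mapping.lookup m i)"
  by (subst mp_eval_superset[of "{m}"]) auto

lemma mp_eval_add: "mp_eval (f + g) x = mp_eval f x + mp_eval g x"
  using mp_eval_superset[of "Poly_Mapping.keys f \<union> Poly_Mapping.keys g" f x]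
    mp_eval_superset[of "Poly_Mapping.keys f \<union> Poly_Mapping.keys g" g x]
    mp_eval_superset[of "Poly_Mapping.keys f \<union> Poly_Mapping.keys g" "f + g" x]
    Poly_Mapping.keys_add[of f g]
  by (simp add: lookup_add distrib_right sum.distrib)

lemma mp_eval_sum: "mp_eval (\<Sum>a\<in>A. f a) x = (\<Sum>a\<in>A. mp_eval (f a) x)"
  by (induction A rule: infinite_finite_induct) (auto simp: mp_eval_add)

text \<open>Only the values of polynomials matter for closed sets, and for functions the closure
  properties below follow by plain computation with values; in particular substituting variables
  and taking determinants need no counterpart on the level of coefficients.\<close>

definition poly_fun :: "(('v::finite \<Rightarrow> complex) \<Rightarrow> complex) \<Rightarrow> bool" where
  "poly_fun \<phi> \<longleftrightarrow> (\<exists>f. \<phi> = mp_eval f)"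

lemma poly_fun_const: "poly_fun (\<lambda>x. c)"
  unfolding poly_fun_def
  by (rule exI[of _ "Poly_Mapping.single 0 c"]) (simp add: fun_eq_iff mp_eval_single)

lemma poly_fun_var: "poly_fun (\<lambda>x. x i)"
proof -
  have "(\<Prod>j\<in>UNIV. x j ^ Poly_Mapping.lookup (Poly_Mapping.single i 1) j) = x i"
    for x :: "'a \<Rightarrow> complex"
  proof -
    have "(\<Prod>j\<in>UNIV. x j ^ Poly_Mapping.lookup (Poly_Mapping.single i 1) j)
        = (\<Prod>j\<in>UNIV. if i = j then x j else 1)"
      by (rule prod.cong) (auto simp: lookup_single)
    then show ?thesis by simp
  qed
  then show ?thesis
    unfolding poly_fun_def
    by (intro exI[of _ "Poly_Mapping.single (Poly_Mapping.single i 1) 1"])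
      (simp add: fun_eq_iff mp_eval_single)
qed

lemma poly_fun_add:
  assumes "poly_fun \<phi>" "poly_fun \<psi>" shows "poly_fun (\<lambda>x. \<phi> x + \<psi> x)"
proof -
  obtain f g where "\<phi> = mp_eval f" "\<psi> = mp_eval g"
    using assms unfolding poly_fun_def by blast
  then show ?thesis
    unfolding poly_fun_def by (intro exI[of _ "f + g"]) (simp add: fun_eq_iff mp_eval_add)
qed

lemma poly_fun_mult:
  assumes "poly_fun \<phi>" "poly_fun \<psi>" shows "poly_fun (\<lambda>x. \<phi> x * \<psi> x)"
proof -
  obtain f g where fg: "\<phi> = mp_eval f" "\<psi> = mp_eval g"
    using assms unfolding poly_fun_def by blast
  let ?h = "\<Sum>m\<in>Poly_Mapping.keys f. \<Sum>m'\<in>Poly_Mapping.keys g.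
    Poly_Mapping.single (m + m') (Poly_Mapping.lookup f m * Poly_Mapping.lookup g m')"
  have "\<phi> x * \<psi> x = mp_eval ?h x" for x
    unfolding fg mp_eval_sum mp_eval_single unfolding mp_eval_def sum_product
    by (intro sum.cong refl) (simp add: lookup_add power_add prod.distrib)
  then show ?thesis unfolding poly_fun_def by (intro exI[of _ ?h] ext)
qed

lemma poly_fun_sum:
  assumes "\<And>a. a \<in> A \<Longrightarrow> poly_fun (\<phi> a)" shows "poly_fun (\<lambda>x. \<Sum>a\<in>A. \<phi> a x)"
  using assms
  by (induction A rule: infinite_finite_induct) (auto intro: poly_fun_const poly_fun_add)

lemma poly_fun_prod:
  assumes "\<And>a. a \<in> A \<Longrightarrow> poly_fun (\<phi> a)" shows "poly_fun (\<lambda>x. \<Prod>a\<in>A. \<phi> a x)"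
  using assms
  by (induction A rule: infinite_finite_induct) (auto intro: poly_fun_const poly_fun_mult)

lemma poly_fun_power:
  assumes "poly_fun \<phi>" shows "poly_fun (\<lambda>x. \<phi> x ^ n)"
  using assms by (induction n) (auto intro: poly_fun_const poly_fun_mult)

lemma poly_fun_rename: "poly_fun (\<lambda>x. mp_eval f (\<lambda>i. x (r i)))"
  unfolding mp_eval_def
  by (intro poly_fun_sum poly_fun_mult poly_fun_const poly_fun_prod poly_fun_power poly_fun_var)

lemma poly_fun_det:
  assumes "\<And>i j. poly_fun (\<lambda>x. A x $ i $ j)" shows "poly_fun (\<lambda>x. det (A x))"
  unfolding det_def
  by (intro poly_fun_sum poly_fun_mult poly_fun_const poly_fun_prod assms)

section \<open>Grading\<close>

text \<open>Multiplying the coefficient of each monomial by a weight yields both the substitution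
  \<open>x \<mapsto> s x\<close> (weight \<open>s\<close> to the degree) and the graded parts of a polynomial (weight one or
  zero).\<close>

definition reweight :: "(('v \<Rightarrow>\<^sub>0 nat) \<Rightarrow> complex) \<Rightarrow> 'v mpoly \<Rightarrow> 'v mpoly" where
  "reweight w f = Poly_Mapping.mapp (\<lambda>m c. w m * c) f"

lemma lookup_reweight: "Poly_Mapping.lookup (reweight w f) m = w m * Poly_Mapping.lookup f m"
  by (simp add: reweight_def lookup_mapp when_def in_keys_iff)

lemma keys_reweight: "Poly_Mapping.keys (reweight w f) \<subseteq> Poly_Mapping.keys f"
  by (auto simp: in_keys_iff lookup_reweight)

lemma mp_eval_reweight:
  "mp_eval (reweight w f) x = (\<Sum>m\<in>Poly_Mapping.keys f.
     w m * (Poly_Mapping.lookup f m * (\<Prod>i\<in>UNIV. x i ^ Poly_Mapping.lookup m i)))"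
  by (subst mp_eval_superset[OF _ keys_reweight]) (auto simp: lookup_reweight mult.assoc)

text \<open>The sum may range over any finite superset of the support, so that polynomials with
  different supports can be compared term by term.\<close>

lemma mp_eval_partial:
  assumes "finite K" "Poly_Mapping.keys f \<subseteq> K"
  shows "mp_eval (mp_partial i f) x = (\<Sum>m\<in>K. of_nat (Poly_Mapping.lookup m i) *
    Poly_Mapping.lookup f m *
    (\<Prod>j\<in>UNIV. x j ^ Poly_Mapping.lookup (m - Poly_Mapping.single i 1) j))"
  unfolding mp_partial_def mp_eval_sum mp_eval_single
  by (rule sum.mono_neutral_left) (use assms in \<open>auto simp: in_keys_iff\<close>)

definition dilate :: "complex \<Rightarrow> 'v::finite mpoly \<Rightarrow> 'v mpoly" where
  "dilate s = reweight (\<lambda>m. s ^ (\<Sum>i\<in>UNIV. Poly_Mapping.lookup m i))"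

lemma mp_eval_dilate: "mp_eval (dilate s f) x = mp_eval f (\<lambda>i. s * x i)"
  unfolding dilate_def mp_eval_reweight
  unfolding mp_eval_def
  by (intro sum.cong) (auto simp: power_mult_distrib prod.distrib power_sum)

text \<open>This is the chain rule for \<open>x \<mapsto> s x\<close>; it makes the tangent space at a projective point
  computable from a single representative.\<close>

lemma mp_eval_partial_dilate:
  "mp_eval (mp_partial i (dilate s f)) x = s * mp_eval (mp_partial i f) (\<lambda>i. s * x i)"
proof -
  (* Differentiation lowers the degree of a monomial by one.  If x_i does not occur, the truncated
     subtraction of exponents keeps the degree, but then both sides vanish. *)
  have *: "of_nat (Poly_Mapping.lookup m i) * s ^ (\<Sum>j\<in>UNIV. Poly_Mapping.lookup m j)
     = s * of_nat (Poly_Mapping.lookup m i) *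
       s ^ (\<Sum>j\<in>UNIV. Poly_Mapping.lookup (m - Poly_Mapping.single i 1) j)"
    for m :: "'a \<Rightarrow>\<^sub>0 nat"
  proof (cases "Poly_Mapping.lookup m i = 0")
    case False
    have "(\<Sum>j\<in>UNIV. Poly_Mapping.lookup m j)
        = (\<Sum>j\<in>UNIV. Poly_Mapping.lookup (m - Poly_Mapping.single i 1) j + (if j = i then 1 else 0))"
      using False by (intro sum.cong) (auto simp: lookup_minus lookup_single when_def)
    also have "\<dots> = Suc (\<Sum>j\<in>UNIV. Poly_Mapping.lookup (m - Poly_Mapping.single i 1) j)"
      by (subst sum.distrib) simp
    finally show ?thesis by simp
  qed simp
  have "mp_eval (mp_partial i (dilate s f)) x
      = (\<Sum>m\<in>Poly_Mapping.keys f.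
          (of_nat (Poly_Mapping.lookup m i) * s ^ (\<Sum>j\<in>UNIV. Poly_Mapping.lookup m j)) *
          (Poly_Mapping.lookup f m *
           (\<Prod>j\<in>UNIV. x j ^ Poly_Mapping.lookup (m - Poly_Mapping.single i 1) j)))"
    unfolding dilate_def
    by (subst mp_eval_partial[OF _ keys_reweight]) (auto simp: lookup_reweight algebra_simps)
  also have "\<dots> = s * mp_eval (mp_partial i f) (\<lambda>i. s * x i)"
    unfolding *
    by (subst mp_eval_partial[OF _ order.refl])
      (auto simp: sum_distrib_left power_mult_distrib prod.distrib power_sum intro!: sum.cong)
  finally show ?thesis .
qed

text \<open>The sum is a polynomial in \<open>s\<close>, and its coefficients are the partial
  sums over the terms with the same exponent.\<close>

lemma vanishing_power_sum_graded_part: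
  fixes c :: "'a \<Rightarrow> complex"
  assumes "finite K" and van: "\<And>s. s \<noteq> 0 \<Longrightarrow> (\<Sum>k\<in>K. c k * s ^ e k) = 0"
  shows "(\<Sum>k\<in>{k\<in>K. e k = d}. c k) = 0"
proof (cases "d \<in> e ` K")
  case True
  (* Raising all exponents by one turns the hypothesis, which excludes s = 0, into the vanishing of
     a polynomial function everywhere. *)
  define n where "n = Suc (Max (e ` K))"
  have le: "Suc (e k) \<le> n" if "k \<in> K" for k
    using that assms(1) by (simp add: n_def)
  have "(\<Sum>i\<le>n. (\<Sum>k\<in>{k\<in>K. Suc (e k) = i}. c k) * s ^ i) = 0" for s
  proof -
    have "(\<Sum>i\<le>n. (\<Sum>k\<in>{k\<in>K. Suc (e k) = i}. c k) * s ^ i)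
        = (\<Sum>i\<le>n. \<Sum>k\<in>{k\<in>K. Suc (e k) = i}. c k * s ^ Suc (e k))"
      by (auto simp: sum_distrib_right intro!: sum.cong)
    also have "\<dots> = (\<Sum>k\<in>K. c k * s ^ Suc (e k))"
      using assms(1) le by (intro sum.group) auto
    also have "\<dots> = s * (\<Sum>k\<in>K. c k * s ^ e k)"
      by (simp add: sum_distrib_left algebra_simps)
    also have "\<dots> = 0" using van[of s] by auto
    finally show ?thesis .
  qed
  then have "(\<Sum>k\<in>{k\<in>K. Suc (e k) = Suc d}. c k) = 0"
    by (rule zero_polynom_imp_zero_coeffs) (use True le in auto)
  then show ?thesis by simp
next
  case False
  then have "{k\<in>K. e k = d} = {}" by auto
  then show ?thesis by (simp only: sum.empty)
qed

definition bihom_part :: "nat \<Rightarrow> nat \<Rightarrow> ('n::finite + 'n) mpoly \<Rightarrow> ('n + 'n) mpoly" where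
  "bihom_part d e = reweight (\<lambda>m. if (\<Sum>i\<in>UNIV. Poly_Mapping.lookup m (Inl i)) = d \<and>
     (\<Sum>i\<in>UNIV. Poly_Mapping.lookup m (Inr i)) = e then 1 else 0)"

lemma bihomogeneous_bihom_part: "bihomogeneous (bihom_part d e f)"
  unfolding bihomogeneous_def
  by (rule exI[of _ d], rule exI[of _ e])
    (auto simp: bihom_part_def in_keys_iff lookup_reweight split: if_splits)

lemma mp_eval_bihom_part:
  "mp_eval (bihom_part d e f) z = (\<Sum>m\<in>{m\<in>{m\<in>Poly_Mapping.keys f.
      (\<Sum>i\<in>UNIV. Poly_Mapping.lookup m (Inl i)) = d}.
      (\<Sum>i\<in>UNIV. Poly_Mapping.lookup m (Inr i)) = e}.
     Poly_Mapping.lookup f m * (\<Prod>i\<in>UNIV. z i ^ Poly_Mapping.lookup m i))"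
  unfolding bihom_part_def mp_eval_reweight
  by (rule sum.mono_neutral_cong_right) auto

lemma prod_UNIV_sum:
  fixes h :: "'a::finite + 'b::finite \<Rightarrow> 'c::comm_monoid_mult"
  shows "(\<Prod>i\<in>UNIV. h i) = (\<Prod>i\<in>UNIV. h (Inl i)) * (\<Prod>i\<in>UNIV. h (Inr i))"
  using prod.Plus[of UNIV UNIV h] by simp

text \<open>Under \<open>x \<mapsto> s x\<close> and \<open>y \<mapsto> t y\<close> the part of bidegree \<open>(d, e)\<close> is multiplied by
  \<open>s\<^sup>d t\<^sup>e\<close>, so it is a coefficient of a polynomial in \<open>s\<close> and \<open>t\<close> that is zero.\<close>

lemma bihom_part_vanishes:
  assumes van: "\<And>s t. s \<noteq> 0 \<Longrightarrow> t \<noteq> 0 \<Longrightarrow>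
    mp_eval f (case_sum (\<lambda>i. s * x i) (\<lambda>i. t * y i)) = 0"
  shows "mp_eval (bihom_part d e f) (case_sum x y) = 0"
proof -
  let ?l = "\<lambda>m. \<Sum>i\<in>UNIV. Poly_Mapping.lookup m (Inl i)"
  let ?r = "\<lambda>m. \<Sum>i\<in>UNIV. Poly_Mapping.lookup m (Inr i)"
  define c where "c m = Poly_Mapping.lookup f m *
    (\<Prod>i\<in>UNIV. case_sum x y i ^ Poly_Mapping.lookup m i)" for m
  have expand: "mp_eval f (case_sum (\<lambda>i. s * x i) (\<lambda>i. t * y i))
      = (\<Sum>m\<in>Poly_Mapping.keys f. c m * t ^ ?r m * s ^ ?l m)" for s t
    unfolding mp_eval_def c_def prod_UNIV_sum
    by (intro sum.cong) (auto simp: power_mult_distrib prod.distrib power_sum)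
  have "(\<Sum>m\<in>{m\<in>Poly_Mapping.keys f. ?l m = d}. c m * t ^ ?r m) = 0" if "t \<noteq> 0" for t
    by (rule vanishing_power_sum_graded_part) (use van that in \<open>auto simp: expand\<close>)
  then have "(\<Sum>m\<in>{m\<in>{m\<in>Poly_Mapping.keys f. ?l m = d}. ?r m = e}. c m) = 0"
    by (rule vanishing_power_sum_graded_part[rotated]) auto
  then show ?thesis by (simp add: mp_eval_bihom_part c_def)
qed

lemma mp_eval_eq_0_if_bihom_parts:
  assumes "\<And>d e. mp_eval (bihom_part d e f) z = 0"
  shows "mp_eval f z = 0"
proof -
  let ?K = "Poly_Mapping.keys f"
  let ?l = "\<lambda>m. \<Sum>i\<in>UNIV. Poly_Mapping.lookup m (Inl i)"
  let ?r = "\<lambda>m. \<Sum>i\<in>UNIV. Poly_Mapping.lookup m (Inr i)"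
  let ?c = "\<lambda>m. Poly_Mapping.lookup f m * (\<Prod>i\<in>UNIV. z i ^ Poly_Mapping.lookup m i)"
  have "mp_eval f z = (\<Sum>d\<in>?l ` ?K. \<Sum>m\<in>{m\<in>?K. ?l m = d}. ?c m)"
    unfolding mp_eval_def by (rule sum.group[symmetric]) auto
  also have "\<dots> = (\<Sum>d\<in>?l ` ?K. \<Sum>e\<in>?r ` ?K. \<Sum>m\<in>{m\<in>{m\<in>?K. ?l m = d}. ?r m = e}. ?c m)"
    by (intro sum.cong refl sum.group[symmetric]) auto
  also have "\<dots> = 0"
    using assms by (simp add: mp_eval_bihom_part)
  finally show ?thesis .
qed

section \<open>Representatives of projective points\<close>

lemma pt_eq_iff:
  assumes "x \<noteq> 0" "y \<noteq> 0"
  shows "pt x = pt y \<longleftrightarrow> (\<exists>c. c \<noteq> 0 \<and> y = c *s x)"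
proof -
  have refl: "proj_eq z z" if "z \<noteq> 0" for z :: "complex^'a"
    using that unfolding proj_eq_def by (auto intro: exI[of _ 1])
  show ?thesis
    using Quotient3_rel[OF Quotient3_cproj, of x y] refl[OF assms(1)] refl[OF assms(2)] assms
    by (auto simp: proj_eq_def)
qed

lemma in_coords_pt_iff:
  assumes "x \<noteq> 0"
  shows "y \<in> coords (pt x) \<longleftrightarrow> (\<exists>c. c \<noteq> 0 \<and> y = c *s x)"
proof (cases "y = 0")
  case True
  then show ?thesis using assms by (auto simp: coords_def)
next
  case False
  then show ?thesis
    unfolding coords_def using pt_eq_iff[OF assms False] by (simp add: eq_commute[of "pt y"])
qed

lemma coords_eq_multiples:
  assumes "x \<in> coords P"
  shows "y \<in> coords P \<longleftrightarrow> (\<exists>c. c \<noteq> 0 \<and> y = c *s x)"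
  using assms in_coords_pt_iff[of x y] by (auto simp: coords_def)

lemma smult_in_coords: "x \<in> coords P \<Longrightarrow> c \<noteq> 0 \<Longrightarrow> c *s x \<in> coords P"
  using coords_eq_multiples by blast

text \<open>A closed set is by definition cut out by bihomogeneous polynomials.  An arbitrary polynomial
  may be used all the same, because it is required to vanish at all representatives of the points
  of \<open>S\<close>: then its bihomogeneous parts do so too.\<close>

lemma poly_fun_vanishes_on_hull:
  fixes S :: "('n::finite cproj \<times> 'n cproj) set"
  assumes \<phi>: "poly_fun \<phi>"
    and van: "\<And>P Q x y. (P, Q) \<in> S \<Longrightarrow> x \<in> coords P \<Longrightarrow> y \<in> coords Q \<Longrightarrow>
      \<phi> (case_sum (($) x) (($) y)) = 0"
    and PQ: "(P, Q) \<in> bi_zariski_closed hull S" "x \<in> coords P" "y \<in> coords Q"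
  shows "\<phi> (case_sum (($) x) (($) y)) = 0"
proof -
  obtain f where f: "\<phi> = mp_eval f" using \<phi> unfolding poly_fun_def by blast
  have "mp_eval (bihom_part d e f) (case_sum (($) x) (($) y)) = 0" for d e
  proof -
    define A where "A = {(P, Q). \<forall>g\<in>{bihom_part d e f}. \<forall>x\<in>coords P. \<forall>y\<in>coords Q.
      mp_eval g (case_sum (($) x) (($) y)) = 0}"
    have "bi_zariski_closed A"
      unfolding bi_zariski_closed_def A_def
      by (rule exI[of _ "{bihom_part d e f}"]) (simp add: bihomogeneous_bihom_part)
    moreover have "S \<subseteq> A"
    proof (clarsimp simp: A_def)
      fix P Q x y assume *: "(P, Q) \<in> S" "x \<in> coords P" "y \<in> coords Q"
      show "mp_eval (bihom_part d e f) (case_sum (($) x) (($) y)) = 0"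
      proof (rule bihom_part_vanishes)
        fix s t :: complex assume "s \<noteq> 0" "t \<noteq> 0"
        then have "\<phi> (case_sum (($) (s *s x)) (($) (t *s y))) = 0"
          using * by (intro van smult_in_coords) auto
        then show "mp_eval f (case_sum (\<lambda>i. s * x $ i) (\<lambda>i. t * y $ i)) = 0"
          unfolding f vector_smult_component[abs_def] .
      qed
    qed
    ultimately have "bi_zariski_closed hull S \<subseteq> A"
      by (rule hull_minimal[rotated])
    then show ?thesis using PQ by (auto simp: A_def)
  qed
  then show ?thesis unfolding f by (rule mp_eval_eq_0_if_bihom_parts)
qed

section \<open>Tangent spaces and gradients\<close>

definition gradient :: "'n::finite mpoly \<Rightarrow> complex^'n \<Rightarrow> complex^'n" where
  "gradient g x = (\<chi> i. mp_eval (mp_partial i g) (($) x))"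

text \<open>The vanishing ideal is stable under \<open>dilate\<close>, so the gradients at another
  representative are multiples of gradients at the given one.\<close>

lemma tangent_space_eq_at_representative:
  assumes x: "x \<in> coords P"
  shows "tangent_space Z P =
    {v. \<forall>g\<in>vanishing_ideal Z. (\<Sum>i\<in>UNIV. gradient g x $ i * v $ i) = 0}" (is "_ = ?T")
proof
  show "tangent_space Z P \<subseteq> ?T"
    using x by (auto simp: tangent_space_def gradient_def)
  show "?T \<subseteq> tangent_space Z P"
  proof
    fix v assume v: "v \<in> ?T"
    show "v \<in> tangent_space Z P"
      unfolding tangent_space_def
    proof clarify
      fix g y assume g: "g \<in> vanishing_ideal Z" and y: "y \<in> coords P"
      obtain s where s: "s \<noteq> 0" "y = s *s x" using y coords_eq_multiples[OF x] by blast
      have "dilate s g \<in> vanishing_ideal Z"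
        unfolding vanishing_ideal_def
      proof clarify
        fix Q z assume "Q \<in> Z" "z \<in> coords Q"
        then have "mp_eval g (($) (s *s z)) = 0"
          using g smult_in_coords[OF _ s(1)] unfolding vanishing_ideal_def by blast
        then show "mp_eval (dilate s g) (($) z) = 0"
          by (simp add: mp_eval_dilate vector_smult_component[abs_def])
      qed
      then have "(\<Sum>i\<in>UNIV. gradient (dilate s g) x $ i * v $ i) = 0" using v by blast
      then have "s * (\<Sum>i\<in>UNIV. mp_eval (mp_partial i g) (($) y) * v $ i) = 0"
        by (simp add: gradient_def mp_eval_partial_dilate s(2) vector_smult_component[abs_def]
            sum_distrib_left mult.assoc)
      then show "(\<Sum>i\<in>UNIV. mp_eval (mp_partial i g) (($) y) * v $ i) = 0" using s(1) by simp
    qed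
  qed
qed

text \<open>The isomorphism \<open>M\<close> maps the common kernel of the rows in \<open>J\<close> onto the coordinate
  subspace where the coordinates in \<open>J\<close> vanish.\<close>

lemma dim_common_kernel_of_rows:
  fixes M :: "'a::field^'n^'n"
  assumes "det M \<noteq> 0"
  shows "vec.dim {v. \<forall>i\<in>J. (\<Sum>j\<in>UNIV. M $ i $ j * v $ j) = 0} = card (- J)"
proof -
  let ?V = "{v. \<forall>i\<in>J. (\<Sum>j\<in>UNIV. M $ i $ j * v $ j) = 0}"
  obtain N where N: "M ** N = mat 1" "N ** M = mat 1"
    using assms unfolding invertible_det_nz[symmetric] invertible_def by blast
  have inj: "inj ((*v) M)" using N(2) matrix_left_invertible_injective by blast
  have "(*v) M ` ?V = {w. \<forall>i. i \<notin> - J \<longrightarrow> w $ i = 0}"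
  proof (intro subset_antisym subsetI)
    fix w assume "w \<in> (*v) M ` ?V"
    then show "w \<in> {w. \<forall>i. i \<notin> - J \<longrightarrow> w $ i = 0}" by (auto simp: matrix_vector_mult_def)
  next
    fix w :: "'a^'n" assume w: "w \<in> {w. \<forall>i. i \<notin> - J \<longrightarrow> w $ i = 0}"
    have eq: "w = M *v (N *v w)" by (simp add: matrix_vector_mul_assoc N)
    have "(\<Sum>j\<in>UNIV. M $ i $ j * (N *v w) $ j) = w $ i" for i
      by (subst (2) eq) (simp add: matrix_vector_mult_def)
    then show "w \<in> (*v) M ` ?V" using w eq by auto
  qed
  moreover have "vec.dim ((*v) M ` ?V) = vec.dim ?V"
    by (rule vec.dim_image_eq[OF matrix_vector_mul_linear_gen]) (rule inj_on_subset[OF inj], simp)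
  ultimately show ?thesis by (simp only: dim_substandard_cart)
qed

lemma basis_as_rows:
  fixes C :: "('a::field^'n) set"
  assumes "vec.independent C" "vec.span C = UNIV"
  obtains h :: "'n \<Rightarrow> 'a^'n" where "bij_betw h UNIV C" "det (\<chi> i. h i) \<noteq> 0"
proof -
  have fin: "finite C" using assms(1) by (rule vec.finiteI_independent)
  have "card C = CARD('n)"
    using vec.dim_eq_card[of C UNIV] assms vec_dim_card[where 'a='a and 'n='n] by simp
  then obtain h :: "'n \<Rightarrow> 'a^'n" where h: "bij_betw h UNIV C"
    using fin finite_same_card_bij[of "UNIV :: 'n set" C] by auto
  have "rows (\<chi> i. h i) = C"
    using h by (auto simp: rows_def row_def bij_betw_def)
  then obtain B :: "'a^'n^'n" where "B ** (\<chi> i. h i) = mat 1"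
    using matrix_left_invertible_span_rows_gen[of "\<chi> i. h i"] assms(2) by metis
  then have "invertible (\<chi> i. h i)"
    unfolding invertible_left_inverse by blast
  then show thesis using that[OF h] by (simp add: invertible_det_nz)
qed

lemma annihilates_span:
  fixes v :: "'a::field^'n"
  assumes "\<And>w. w \<in> B \<Longrightarrow> (\<Sum>j\<in>UNIV. w $ j * v $ j) = 0" "w \<in> vec.span B"
  shows "(\<Sum>j\<in>UNIV. w $ j * v $ j) = 0"
  using assms(2)
  by (induction rule: vec.span_induct_alt)
    (auto simp: assms(1) distrib_right sum.distrib mult.assoc simp flip: sum_distrib_left)

text \<open>The rank of the gradients of the polynomials vanishing on \<open>Z\<close> is the same at all regular
  points, so the condition that \<open>q\<close> lies in their span is closed over the regular locus.  A
  determinant that detects a violation of it at the given point, but vanishes on the conormal pairs,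
  makes this precise.\<close>

theorem conormal_fibre_over_regular_point:
  fixes Z :: "'n::finite cproj set"
  assumes PQ: "(P, Q) \<in> conormal Z" and P: "P \<in> reg_points Z"
    and p: "p \<in> coords P" and q: "q \<in> coords Q"
  shows "perp q (tangent_space Z P)"
proof (rule ccontr)
  assume nperp: "\<not> perp q (tangent_space Z P)"
  define G where "G = (\<lambda>g. gradient g p) ` vanishing_ideal Z"
  obtain B where B: "B \<subseteq> G" "vec.independent B" "G \<subseteq> vec.span B"
    using vec.maximal_independent_subset[of G] by blast
  have T: "tangent_space Z P = {v. \<forall>w\<in>B. (\<Sum>j\<in>UNIV. w $ j * v $ j) = 0}"
    unfolding tangent_space_eq_at_representative[OF p]
    using B(1,3) annihilates_span[of B] unfolding G_def by blast
  have qB: "q \<notin> vec.span B"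
    using nperp annihilates_span[of B _ q] unfolding perp_def T by blast
  define C where "C = vec.extend_basis (insert q B)"
  have indep: "vec.independent (insert q B)" using qB B(2) by (rule vec.independent_insertI)
  have C: "insert q B \<subseteq> C" "vec.independent C" "vec.span C = UNIV"
    unfolding C_def
    by (rule vec.extend_basis_superset[OF indep] vec.independent_extend_basis[OF indep]
        vec.span_extend_basis[OF indep])+
  obtain h :: "'n \<Rightarrow> complex^'n" where h: "bij_betw h UNIV C" "det (\<chi> i. h i) \<noteq> 0"
    using basis_as_rows[OF C(2,3)] .
  obtain a where a: "h a = q" using h(1) C(1) by (metis bij_betw_iff_bijections insert_subset)
  define J where "J = h -` B"
  have aJ: "a \<notin> J" using qB a vec.span_base by (auto simp: J_def)
  have hJ: "h ` J = B" using h(1) C(1) by (auto simp: J_def bij_betw_def)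
  have "\<exists>g\<in>vanishing_ideal Z. gradient g p = h i" if "i \<in> J" for i
    using that B(1) unfolding J_def G_def by fastforce
  then obtain g where g: "\<And>i. i \<in> J \<Longrightarrow> g i \<in> vanishing_ideal Z \<and> gradient (g i) p = h i"
    by metis
  have dimT: "vec.dim (tangent_space Z P) = card (- J)"
    using dim_common_kernel_of_rows[OF h(2), of J] unfolding T hJ[symmetric] by simp
  (* The nonsingular matrix with rows h i is the value at (p, q) of a matrix of polynomials: the row q
     becomes the second group of variables, the gradients in B vary with the first group, and the
     rows that complete the basis stay constant. *)
  define M where "M z = (\<chi> i j. if i = a then z (Inr j)
    else if i \<in> J then mp_eval (mp_partial j (g i)) (\<lambda>k. z (Inl k)) else h i $ j)"
    for z :: "'n + 'n \<Rightarrow> complex"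
  have M: "M (case_sum (($) x) (($) y)) $ i =
    (if i = a then y else if i \<in> J then gradient (g i) x else h i)" for x y i
    by (simp add: M_def vec_eq_iff gradient_def)
  have "poly_fun (\<lambda>z. M z $ i $ j)" for i j
    by (cases "i = a"; cases "i \<in> J")
      (simp_all add: M_def poly_fun_var poly_fun_const poly_fun_rename)
  then have poly: "poly_fun (\<lambda>z. det (M z))" by (rule poly_fun_det)
  have "det (M (case_sum (($) p) (($) q))) = 0"
  proof (rule poly_fun_vanishes_on_hull[OF poly _ PQ[unfolded conormal_def] p q], clarify)
    fix P' Q' x y
    assume P': "P' \<in> reg_points Z" and perp: "\<forall>q\<in>coords Q'. perp q (tangent_space Z P')"
      and x: "x \<in> coords P'" and y: "y \<in> coords Q'"
    let ?M = "M (case_sum (($) x) (($) y))"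
    show "det ?M = 0"
    proof (rule ccontr)
      assume nz: "det ?M \<noteq> 0"
      (* The rows in J and the row y all annihilate the tangent space, one independent row more than
         its dimension permits. *)
      have "tangent_space Z P' \<subseteq>
          {v. \<forall>i\<in>insert a J. (\<Sum>j\<in>UNIV. ?M $ i $ j * v $ j) = 0}"
        using perp y g aJ unfolding M perp_def tangent_space_eq_at_representative[OF x] by auto
      then have "vec.dim (tangent_space Z P') \<le> card (- insert a J)"
        unfolding dim_common_kernel_of_rows[OF nz, symmetric] by (rule vec.dim_subset)
      also have "\<dots> < card (- J)" using aJ by (intro psubset_card_mono) auto
      also have "\<dots> = vec.dim (tangent_space Z P')"
        using P P' unfolding dimT[symmetric] reg_points_def
        by (metis (mono_tags, lifting) enat.inject mem_Collect_eq)
      finally show False by simp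
    qed
  qed
  moreover have "M (case_sum (($) p) (($) q)) = (\<chi> i. h i)"
    using g a by (simp add: vec_eq_iff[of "M _"] M)
  ultimately show False using h(2) by simp
qed

section \<open>Critical points\<close>

lemma perp_smult: "perp q T \<Longrightarrow> perp (c *s q) T"
  by (simp add: perp_def mult.assoc flip: sum_distrib_left)

theorem theorem4:
  fixes F :: "'n::finite mpoly set"
    and u :: "complex^'n"
    and p :: "complex^('n option)"
  assumes "statistical_model F"
    and "\<And>i. u $ i \<noteq> 0"
    and "(\<Sum>i\<in>UNIV. u $ i) \<noteq> 0"
    and "p \<noteq> 0"
    and "pt p \<in> reg_points (extended_model F)"
  shows "(\<exists>b. b \<noteq> 0 \<and> (pt p, pt b) \<in> conormal (extended_model F) \<and>
              proj_eq (\<chi> i. p $ i * b $ i) (extended_data u))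
         \<longleftrightarrow> critical_point u (extended_model F) (pt p)"
proof
  let ?Z = "extended_model F"
  have u: "extended_data u $ i \<noteq> 0" for i
    using assms(2,3) by (cases i) (auto simp: extended_data_def)
  have p: "p \<in> coords (pt p)" using assms(4) by (simp add: coords_def)
  {
    assume "\<exists>b. b \<noteq> 0 \<and> (pt p, pt b) \<in> conormal ?Z \<and>
      proj_eq (\<chi> i. p $ i * b $ i) (extended_data u)"
    then obtain b c where b: "b \<noteq> 0" "(pt p, pt b) \<in> conormal ?Z"
      and eq: "extended_data u = c *s (\<chi> i. p $ i * b $ i)"
      unfolding proj_eq_def by blast
    have perp: "perp b (tangent_space ?Z (pt p))"
      using b conormal_fibre_over_regular_point[OF b(2) assms(5) p] by (simp add: coords_def)
    have eq': "extended_data u $ i = c * (p $ i * b $ i)" for i by (simp add: eq)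
    have p0: "p $ i \<noteq> 0" for i using u[of i] by (auto simp: eq')
    show "critical_point u ?Z (pt p)"
      unfolding critical_point_def
    proof (intro conjI ballI assms(5))
      fix x assume "x \<in> coords (pt p)"
      then obtain s where s: "s \<noteq> 0" "x = s *s p" using coords_eq_multiples[OF p] by blast
      show "(\<Prod>i\<in>UNIV. x $ i) \<noteq> 0" using s p0 by simp
      have "likelihood_grad u x = (c / s) *s b"
        using s p0 by (simp add: likelihood_grad_def vec_eq_iff eq')
      then show "perp (likelihood_grad u x) (tangent_space ?Z (pt p))"
        using perp_smult[OF perp] by simp
    qed
  next
    assume crit: "critical_point u ?Z (pt p)"
    define b where "b = likelihood_grad u p"
    have p0: "p $ i \<noteq> 0" for i using crit p by (auto simp: critical_point_def)
    have perp: "perp b (tangent_space ?Z (pt p))"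
      using crit p by (simp add: critical_point_def b_def)
    have pb: "(\<chi> i. p $ i * b $ i) = extended_data u"
      using p0 by (simp add: vec_eq_iff b_def likelihood_grad_def)
    have u0: "extended_data u \<noteq> 0" using u by (metis zero_index)
    have b0: "b \<noteq> 0"
    proof
      assume "b = 0"
      then have "extended_data u = 0" by (simp add: pb[symmetric] vec_eq_iff)
      then show False using u0 by contradiction
    qed
    have "(pt p, pt b) \<in> {(P, Q). P \<in> reg_points ?Z \<and> (\<forall>q\<in>coords Q. perp q (tangent_space ?Z P))}"
      using assms(5) perp b0 by (auto simp: in_coords_pt_iff intro: perp_smult)
    then have "(pt p, pt b) \<in> conormal ?Z"
      unfolding conormal_def by (rule hull_inc)
    moreover have "proj_eq (\<chi> i. p $ i * b $ i) (extended_data u)"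
      unfolding pb proj_eq_def using u0 by (auto intro: exI[of _ 1])
    ultimately show "\<exists>b. b \<noteq> 0 \<and> (pt p, pt b) \<in> conormal ?Z \<and>
        proj_eq (\<chi> i. p $ i * b $ i) (extended_data u)"
      using b0 by blast
  }
qed

end
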